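(* Let $\mathbb K=\mathbb R$ or $\mathbb C$, let $\mathbf A\in\mathbb K^{n\times n}$ and $\mathbf H\in\mathbb K^{n\times n}$ be non-singular, let $\mathbf W\in\mathbb K^{n\times n}$ be Hermitian positive definite, and let $\mathbf b,\mathbf x_0\in\mathbb K^n$ with $\mathbf r_0=\mathbf b-\mathbf A\mathbf x_0\ne\mathbf 0$. For every $i$ such that the $i$-th iterate of WP-GCR with right preconditioner $\mathbf H$ and weight matrix $\mathbf W$ is defined, its residual $\mathbf r_i$ satisfies $$\frac{\|\mathbf r_i\|_{\mathbf W}}{\|\mathbf r_0\|_{\mathbf W}}\le\left(1-\inf_{\mathbf y\ne\mathbf 0}\frac{|\langle\mathbf A\mathbf H\mathbf y,\mathbf y\rangle_{\mathbf W}|^2}{\|\mathbf A\mathbf H\mathbf y\|_{\mathbf W}^2\,\|\mathbf y\|_{\mathbf W}^2}\right)^{i/2},$$ where the infimum is over nonzero $\mathbf y\in\mathbb K^n$.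
   Context: $n\ge1$. $\langle\mathbf x,\mathbf y\rangle=\mathbf y^*\mathbf x$, $\langle\mathbf x,\mathbf y\rangle_{\mathbf W}=\mathbf y^*\mathbf W\mathbf x$, $\|\mathbf x\|_{\mathbf W}=\langle\mathbf x,\mathbf x\rangle_{\mathbf W}^{1/2}$. WP-GCR with right preconditioning: set $\mathbf r_0=\mathbf b-\mathbf A\mathbf x_0$, $\mathbf z_0=\mathbf H\mathbf r_0$, $\mathbf p_0=\mathbf z_0$, $\mathbf q_0=\mathbf A\mathbf p_0$. For $i=0,1,\dots$: $\delta_i=\langle\mathbf q_i,\mathbf q_i\rangle_{\mathbf W}$, $\gamma_i=\langle\mathbf r_i,\mathbf q_i\rangle_{\mathbf W}$, $\alpha_i=\gamma_i/\delta_i$; $\mathbf x_{i+1}=\mathbf x_i+\alpha_i\mathbf p_i$, $\mathbf r_{i+1}=\mathbf r_i-\alpha_i\mathbf q_i$, $\mathbf z_{i+1}=\mathbf H\mathbf r_{i+1}$; $\beta_{i,j}=\langle\mathbf A\mathbf z_{i+1},\mathbf q_j\rangle_{\mathbf W}/\delta_j$ for $j=0,\dots,i$; $\mathbf p_{i+1}=\mathbf z_{i+1}-\sum_{j=0}^i\beta_{i,j}\mathbf p_j$, $\mathbf q_{i+1}=\mathbf A\mathbf z_{i+1}-\sum_{j=0}^i\beta_{i,j}\mathbf q_j$. The $i$-th iterate $\mathbf x_i$ (with residual $\mathbf r_i=\mathbf b-\mathbf A\mathbf x_i$) is defined as long as $\delta_0,\dots,\delta_{i-1}$ are all nonzero.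 *)

theory Defs
  imports "HOL-Analysis.Analysis"
begin

text \<open>
  A common interface to \<open>\<real>\<close> and \<open>\<complex>\<close>. The lemma \<open>real_or_complex_dichotomy\<close> below shows that
  the class has no other members up to isomorphism.
\<close>

class real_or_complex = real_normed_field +
  fixes conjg :: "'a \<Rightarrow> 'a" and repart :: "'a \<Rightarrow> real"
  assumes conjg_add: "conjg (x + y) = conjg x + conjg y"
    and mult_conjg_scaleR: "x * conjg x = ((norm x)\<^sup>2) *\<^sub>R 1"
    and repart_scaleR: "(2 * repart x) *\<^sub>R 1 = x + conjg x"

instantiation real :: real_or_complex
begin
definition conjg_real :: "real \<Rightarrow> real" where "conjg_real x = x"
definition repart_real :: "real \<Rightarrow> real" where "repart_real x = x"
instance
  by standard (auto simp: conjg_real_def repart_real_def power2_eq_square)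
end

instantiation complex :: real_or_complex
begin
definition conjg_complex :: "complex \<Rightarrow> complex" where "conjg_complex = cnj"
definition repart_complex :: "complex \<Rightarrow> real" where "repart_complex = Re"
instance
  by standard
    (auto simp: conjg_complex_def repart_complex_def complex_norm_square[symmetric]
      complex_eq_iff cmod_power2 power2_eq_square)
end

lemma mult_conjg: "x * conjg x = (of_real ((norm x)\<^sup>2) :: 'a::real_or_complex)"
  unfolding of_real_def by (rule mult_conjg_scaleR)

lemma of_real_repart: "of_real (repart x) = (x + conjg x :: 'a::real_or_complex) / 2"
  unfolding repart_scaleR[symmetric] of_real_def[symmetric] by simp

lemma conjg_of_real: "conjg (of_real t :: 'a::real_or_complex) = of_real t"
proof (cases "t = 0")
  case True
  have "conjg (0::'a) + conjg 0 = conjg 0" using conjg_add[of "0::'a" 0] by simp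
  then show ?thesis using True by simp
next
  case False
  then show ?thesis using mult_conjg[of "of_real t :: 'a"]
    by (simp add: power2_eq_square)
qed

lemma conjg_mult: "conjg (x * y :: 'a::real_or_complex) = conjg x * conjg y"
proof (cases "x * y = 0")
  case True
  then show ?thesis using conjg_of_real[of 0, where 'a = 'a] by auto
next
  case False
  have "(x * y) * conjg (x * y) = (x * conjg x) * (y * conjg y)"
    by (simp add: mult_conjg norm_mult power_mult_distrib)
  also have "\<dots> = (x * y) * (conjg x * conjg y)" by (simp add: mult_ac)
  finally show ?thesis using False by simp
qed

lemma conjg_conjg: "conjg (conjg x :: 'a::real_or_complex) = x"
proof (cases "x = 0")
  case True
  then show ?thesis using conjg_of_real[of 0, where 'a = 'a] by simp
next
  case False
  have nz: "conjg x \<noteq> 0" using mult_conjg[of x] False by auto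
  have "conjg x * conjg (conjg x) = conjg (x * conjg x)" by (simp add: conjg_mult)
  also have "\<dots> = conjg x * x" by (metis conjg_of_real mult_conjg mult.commute)
  finally show ?thesis using nz by simp
qed

lemma conjg_diff: "conjg (x - y :: 'a::real_or_complex) = conjg x - conjg y"
  using conjg_add[of "x - y" y] by simp

lemma repart_self_conjugate:
  assumes "conjg x = (x :: 'a::real_or_complex)"
  shows "x = of_real (repart x)"
  using of_real_repart[of x] assms by simp

lemma real_or_complex_dichotomy:
  "(\<forall>x::'a::real_or_complex. x = of_real (repart x) \<and> conjg x = x) \<or>
   (\<exists>j::'a. j * j = - 1 \<and>
      (\<forall>x. \<exists>c. x = of_real (repart x) + of_real c * j \<and> conjg x = of_real (repart x) - of_real c * j))"
proof (cases "\<forall>x::'a. conjg x = x")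
  case True
  then show ?thesis using repart_self_conjugate by blast
next
  case False
  then obtain u :: 'a where u: "conjg u \<noteq> u" by blast
  define d where "d = u - conjg u"
  define j where "j = d / of_real (norm d)"
  have d: "d \<noteq> 0" "conjg d = - d" using u by (auto simp: d_def conjg_diff conjg_conjg)
  have dd: "d * d = - of_real ((norm d)\<^sup>2)" using mult_conjg[of d] d(2)
    by (metis minus_equation_iff mult_minus_right)
  have jj: "j * j = - 1" using d(1) by (simp add: j_def dd power2_eq_square)
  have cj: "conjg j = - j"
  proof -
    have "conjg (j * of_real (norm d)) = - (j * of_real (norm d))"
      using d by (simp add: j_def)
    then have "conjg j * of_real (norm d) = (- j) * of_real (norm d)"
      by (simp add: conjg_mult conjg_of_real)
    then show ?thesis using d(1) by (metis mult_right_cancel norm_eq_zero of_real_eq_0_iff)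
  qed
  have "\<exists>c. x = of_real (repart x) + of_real c * j \<and> conjg x = of_real (repart x) - of_real c * j"
    for x :: 'a
  proof -
    define e where "e = (conjg x - x) * j"
    have "conjg e = e" by (simp add: e_def conjg_mult conjg_diff conjg_conjg cj algebra_simps)
    then have e: "e = of_real (repart e)" by (rule repart_self_conjugate)
    have "of_real (repart e) * j = x - conjg x"
      unfolding e[symmetric] by (simp add: e_def mult.assoc jj)
    then have h: "of_real (repart e / 2) * j = (x - conjg x) / 2" by simp
    have "x = of_real (repart x) + of_real (repart e / 2) * j"
      "conjg x = of_real (repart x) - of_real (repart e / 2) * j"
      unfolding h of_real_repart by (simp_all add: field_simps)
    then show ?thesis by blast
  qed
  then show ?thesis using jj by blast
qed

text \<open>
  Inner products are linear in the first and conjugate linear in the second argument: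
  \<open>winner W x y\<close> is \<open>y\<^sup>* W x\<close>.
\<close>

definition cdot :: "'a::real_or_complex ^ 'n \<Rightarrow> 'a ^ 'n \<Rightarrow> 'a" where
  "cdot x y = (\<Sum>k\<in>UNIV. conjg (y $ k) * x $ k)"

definition winner :: "'a::real_or_complex ^ 'n ^ 'n \<Rightarrow> 'a ^ 'n \<Rightarrow> 'a ^ 'n \<Rightarrow> 'a" where
  "winner W x y = cdot (W *v x) y"

definition wnorm :: "'a::real_or_complex ^ 'n ^ 'n \<Rightarrow> 'a ^ 'n \<Rightarrow> real" where
  "wnorm W x = sqrt (repart (winner W x x))"

definition hermitian :: "'a::real_or_complex ^ 'n ^ 'n \<Rightarrow> bool" where
  "hermitian W \<longleftrightarrow> (\<forall>k l. W $ k $ l = conjg (W $ l $ k))"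

definition hermitian_posdef :: "'a::real_or_complex ^ 'n ^ 'n \<Rightarrow> bool" where
  "hermitian_posdef W \<longleftrightarrow> hermitian W \<and> (\<forall>x. x \<noteq> 0 \<longrightarrow> 0 < repart (winner W x x))"

text \<open>The quotients \<open>\<alpha>\<^sub>i = \<gamma>\<^sub>i / \<delta>\<^sub>i\<close> and \<open>\<beta>\<^sub>i\<^sub>j\<close> are both of this form:\<close>

definition wcoeff :: "'a::real_or_complex ^ 'n ^ 'n \<Rightarrow> 'a ^ 'n \<Rightarrow> 'a ^ 'n \<Rightarrow> 'a" where
  "wcoeff W v q = winner W v q / winner W q q"

datatype 'v gcr_state = GCR_State (st_x: 'v) (st_r: 'v) (st_z: 'v) (st_p: 'v) (st_q: 'v)

text \<open>
  The functions below are total because \<open>x / 0 = 0\<close>; the state with index \<open>i\<close> is meaningful only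
  if \<open>gcr_delta\<close> is nonzero at all indices below \<open>i\<close>, which is \<open>gcr_defined\<close>.
\<close>

context
  fixes A H W :: "'a::real_or_complex ^ 'n ^ 'n" and b x0 :: "'a ^ 'n"
begin

fun gcr :: "nat \<Rightarrow> ('a ^ 'n) gcr_state" where
  "gcr 0 =
    (let r = b - A *v x0;
         z = H *v r
     in GCR_State x0 r z z (A *v z))"
| "gcr (Suc i) =
    (let s = gcr i;
         \<alpha> = wcoeff W (st_r s) (st_q s);
         x = st_x s + \<alpha> *s st_p s;
         r = st_r s - \<alpha> *s st_q s;
         z = H *v r
     in GCR_State x r z
          (z - (\<Sum>j\<in>{..i}. wcoeff W (A *v z) (st_q (gcr j)) *s st_p (gcr j)))
          (A *v z - (\<Sum>j\<in>{..i}. wcoeff W (A *v z) (st_q (gcr j)) *s st_q (gcr j))))"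

definition gcr_x :: "nat \<Rightarrow> 'a ^ 'n" where "gcr_x i = st_x (gcr i)"
definition gcr_r :: "nat \<Rightarrow> 'a ^ 'n" where "gcr_r i = st_r (gcr i)"

definition gcr_delta :: "nat \<Rightarrow> 'a" where
  "gcr_delta i = winner W (st_q (gcr i)) (st_q (gcr i))"

definition gcr_defined :: "nat \<Rightarrow> bool" where
  "gcr_defined i \<longleftrightarrow> (\<forall>j<i. gcr_delta j \<noteq> 0)"

end

lemma gcr_image: "st_q (gcr A H W b x0 i) = A *v st_p (gcr A H W b x0 i)"
proof (induction i rule: less_induct)
  case (less i)
  have sc: "A *v (c *s v) = c *s (A *v v)" for c v
    by (simp add: vec_eq_iff matrix_vector_mult_def sum_distrib_left mult_ac)
  have add: "A *v (v + w) = A *v v + A *v w" for v w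
    by (simp add: vec_eq_iff matrix_vector_mult_def distrib_left sum.distrib)
  have zero: "A *v 0 = 0"
    by (simp add: vec_eq_iff matrix_vector_mult_def)
  have sm: "A *v (\<Sum>j\<in>J. f j) = (\<Sum>j\<in>J. A *v f j)" if "finite J" for J :: "nat set" and f
    using that by (induction rule: finite_induct) (simp_all add: add zero)
  have df: "A *v (v - w) = A *v v - A *v w" for v w
    by (metis add add_diff_cancel_right' diff_add_cancel)
  show ?case
  proof (cases i)
    case 0
    then show ?thesis by (simp add: Let_def)
  next
    case (Suc m)
    then show ?thesis using less by (simp add: Let_def df sm sc)
  qed
qed

text \<open>The recursively computed residual is the residual of the iterate:\<close>

lemma gcr_r_residual: "gcr_r A H W b x0 i = b - A *v gcr_x A H W b x0 i"
proof (induction i)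
  case 0
  then show ?case by (simp add: gcr_r_def gcr_x_def Let_def)
next
  case (Suc i)
  have sc: "A *v (c *s v) = c *s (A *v v)" for c v
    by (simp add: vec_eq_iff matrix_vector_mult_def sum_distrib_left mult_ac)
  have add: "A *v (v + w) = A *v v + A *v w" for v w
    by (simp add: vec_eq_iff matrix_vector_mult_def distrib_left sum.distrib)
  show ?case using Suc by (simp add: gcr_r_def gcr_x_def Let_def add sc gcr_image)
qed

end

theory Submission imports Defs begin

text \<open>
  Write \<open>B = A H\<close>. The directions \<open>q\<^sub>0, q\<^sub>1, \<dots>\<close> come from a Gram-Schmidt process for the \<open>W\<close>-inner
  product, so they are \<open>W\<close>-orthogonal (\<open>gcr_q_orthogonal\<close>), and \<open>r\<^sub>i\<close> is what remains of \<open>r\<^sub>0\<close> once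
  its components along \<open>q\<^sub>0, \<dots>, q\<^sub>i\<^sub>-\<^sub>1\<close> have been removed (\<open>gcr_r_orthogonal\<close>). One further step
  subtracts the component along \<open>q\<^sub>i\<close>, so by Pythagoras
  \[ \|r_{i+1}\|^2 = \|r_i\|^2 - |\langle r_i, q_i\rangle|^2 / \|q_i\|^2. \]
  Now \<open>q\<^sub>i\<close> is \<open>B r\<^sub>i\<close> minus a combination of the earlier directions. Those are orthogonal to \<open>r\<^sub>i\<close>,
  hence \<open>\<langle>r\<^sub>i, q\<^sub>i\<rangle> = \<langle>r\<^sub>i, B r\<^sub>i\<rangle>\<close>; and they are orthogonal to \<open>q\<^sub>i\<close>, hence \<open>\<parallel>q\<^sub>i\<parallel> \<le> \<parallel>B r\<^sub>i\<parallel>\<close>. Thus one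
  step of the full method reduces the residual at least as much as one step of plain residual
  minimization along \<open>B r\<^sub>i\<close>:
  \[ \|r_{i+1}\|^2 \le \Bigl(1 - \frac{|\langle B r_i, r_i\rangle|^2}{\|B r_i\|^2 \|r_i\|^2}\Bigr) \|r_i\|^2 \]
  (\<open>gcr_r_step\<close>). The quotient is one of those over which the infimum is taken, and induction on
  \<open>i\<close> gives the bound.
\<close>

section \<open>The weighted inner product\<close>

lemma conjg_0 [simp]: "conjg (0 :: 'a::real_or_complex) = 0"
  using conjg_of_real[of 0, where 'a = 'a] by simp

lemma conjg_sum: "conjg (sum f S) = (\<Sum>x\<in>S. conjg (f x :: 'a::real_or_complex))"
  by (induction S rule: infinite_finite_induct) (simp_all add: conjg_add)

lemma norm_conjg [simp]: "norm (conjg x) = norm (x :: 'a::real_or_complex)"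
proof (cases "x = 0")
  case False
  have "norm x * norm (conjg x) = norm x * norm x"
    using arg_cong[OF mult_conjg[of x], of norm]
    by (simp add: norm_mult norm_power power2_eq_square del: of_real_power of_real_mult)
  then show ?thesis using False by simp
qed simp

lemma winner_as_sum:
  "winner W x y = (\<Sum>k\<in>UNIV. \<Sum>l\<in>UNIV. conjg (y $ k) * W $ k $ l * x $ l)"
  by (simp add: winner_def cdot_def matrix_vector_mult_def sum_distrib_left mult.assoc)

lemma winner_add_left: "winner W (x + y) v = winner W x v + winner W y v"
  by (simp add: winner_as_sum distrib_left sum.distrib)

lemma winner_diff_left: "winner W (x - y) v = winner W x v - winner W y v"
  using winner_add_left[of W "x - y" y v] by (simp add: algebra_simps)

lemma winner_scale_left: "winner W (c *s x) v = c * winner W x v"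
  by (simp add: winner_as_sum sum_distrib_left mult_ac)

lemma winner_zero_left [simp]: "winner W 0 v = 0"
  by (simp add: winner_as_sum)

lemma winner_sum_left: "winner W (sum f S) v = (\<Sum>j\<in>S. winner W (f j) v)"
  by (induction S rule: infinite_finite_induct) (simp_all add: winner_add_left)

lemma winner_conjg:
  assumes "hermitian W"
  shows "winner W y x = conjg (winner W x y)"
proof -
  have W: "conjg (W $ k $ l) = W $ l $ k" for k l
    using assms unfolding hermitian_def by metis
  have "conjg (winner W x y) = (\<Sum>k\<in>UNIV. \<Sum>l\<in>UNIV. conjg (x $ l) * W $ l $ k * y $ k)"
    by (simp add: winner_as_sum conjg_sum conjg_mult conjg_conjg W mult_ac)
  also have "\<dots> = winner W y x"
    unfolding winner_as_sum by (rule sum.swap)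
  finally show ?thesis by simp
qed

context
  fixes W :: "'a::real_or_complex ^ 'n ^ 'n"
  assumes W: "hermitian_posdef W"
begin

lemma winner_commute_conjg: "winner W y x = conjg (winner W x y)"
  using W winner_conjg unfolding hermitian_posdef_def by blast

lemma winner_orthogonal_sym: "winner W x y = 0 \<Longrightarrow> winner W y x = 0"
  using winner_commute_conjg[of y x] by simp

lemma winner_orthogonal_sum:
  assumes "\<And>j. j \<in> S \<Longrightarrow> winner W x (f j) = 0"
  shows "winner W x (\<Sum>j\<in>S. c j *s f j) = 0"
proof (rule winner_orthogonal_sym)
  have "winner W (f j) x = 0" if "j \<in> S" for j
    using assms[OF that] by (rule winner_orthogonal_sym)
  then show "winner W (\<Sum>j\<in>S. c j *s f j) x = 0"
    by (simp add: winner_sum_left winner_scale_left)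
qed

lemma wnorm_pos: "x \<noteq> 0 \<Longrightarrow> 0 < wnorm W x"
  using W unfolding hermitian_posdef_def wnorm_def by simp

lemma winner_self: "winner W x x = of_real ((wnorm W x)\<^sup>2)"
proof (cases "x = 0")
  case True
  have "repart (0::'a) = 0"
    using of_real_repart[of "0::'a"] by simp
  then show ?thesis using True by (simp add: wnorm_def)
next
  case False
  then have "0 < repart (winner W x x)"
    using W unfolding hermitian_posdef_def by blast
  then have "(wnorm W x)\<^sup>2 = repart (winner W x x)"
    by (simp add: wnorm_def)
  then show ?thesis
    using repart_self_conjugate[OF winner_commute_conjg[of x x, symmetric]] by (simp only:)
qed

lemma wnorm_nonneg: "0 \<le> wnorm W x"
  using wnorm_pos[of x] winner_self[of 0] by (cases "x = 0") auto

lemma wnorm_scale_square: "(wnorm W (c *s x))\<^sup>2 = (norm c)\<^sup>2 * (wnorm W x)\<^sup>2"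
proof -
  have "of_real ((wnorm W (c *s x))\<^sup>2) = c * winner W x (c *s x)"
    using winner_self[of "c *s x"] winner_scale_left[of W c x "c *s x"] by (rule trans[OF sym])
  also have "\<dots> = (c * conjg c) * conjg (winner W x x)"
    using winner_commute_conjg[of x "c *s x"] by (simp add: winner_scale_left conjg_mult)
  also have "\<dots> = (of_real ((norm c)\<^sup>2 * (wnorm W x)\<^sup>2) :: 'a)"
    by (simp only: mult_conjg winner_self conjg_of_real of_real_mult)
  finally show ?thesis by (simp only: of_real_eq_iff)
qed

lemma wnorm_pythagoras:
  assumes "winner W u v = 0"
  shows "(wnorm W (u + v))\<^sup>2 = (wnorm W u)\<^sup>2 + (wnorm W v)\<^sup>2"
proof -
  have left: "winner W (u + v) u = winner W u u" "winner W (u + v) v = winner W v v"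
    using assms winner_orthogonal_sym[OF assms] by (simp_all add: winner_add_left)
  have right: "winner W u (u + v) = winner W u u" "winner W v (u + v) = winner W v v"
    using winner_commute_conjg[of u "u + v"] winner_commute_conjg[of v "u + v"]
    unfolding left winner_commute_conjg[of u u, symmetric] winner_commute_conjg[of v v, symmetric] .
  have "(of_real ((wnorm W (u + v))\<^sup>2) :: 'a) = of_real ((wnorm W u)\<^sup>2 + (wnorm W v)\<^sup>2)"
    using winner_add_left[of W u v "u + v"] unfolding right winner_self of_real_add .
  then show ?thesis by (simp only: of_real_eq_iff)
qed

lemma wnorm_remove_component:
  assumes "winner W q q \<noteq> 0"
  shows "(wnorm W (v - wcoeff W v q *s q))\<^sup>2
    = (wnorm W v)\<^sup>2 - (norm (winner W v q))\<^sup>2 / (wnorm W q)\<^sup>2"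
proof -
  let ?c = "wcoeff W v q"
  have q: "wnorm W q \<noteq> 0" using assms winner_self[of q] by auto
  have "winner W (v - ?c *s q) q = 0"
    using assms by (simp add: winner_diff_left winner_scale_left wcoeff_def)
  then have "winner W (?c *s q) (v - ?c *s q) = 0"
    by (simp add: winner_scale_left winner_orthogonal_sym[of "v - ?c *s q"])
  then have "winner W (v - ?c *s q) (?c *s q) = 0"
    by (rule winner_orthogonal_sym)
  then have "(wnorm W v)\<^sup>2 = (wnorm W (v - ?c *s q))\<^sup>2 + (norm ?c)\<^sup>2 * (wnorm W q)\<^sup>2"
    using wnorm_pythagoras[of "v - ?c *s q" "?c *s q"] by (simp add: wnorm_scale_square)
  moreover have "(norm ?c)\<^sup>2 * (wnorm W q)\<^sup>2 = (norm (winner W v q))\<^sup>2 / (wnorm W q)\<^sup>2"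
    using q by (simp add: wcoeff_def winner_self norm_divide power_divide power2_eq_square
        flip: of_real_mult)
  ultimately show ?thesis by simp
qed

lemma gram_schmidt_orthogonal:
  assumes "finite S" "k \<in> S" "winner W (q k) (q k) \<noteq> 0"
    and orth: "\<And>j. j \<in> S \<Longrightarrow> j \<noteq> k \<Longrightarrow> winner W (q j) (q k) = 0"
  shows "winner W (v - (\<Sum>j\<in>S. wcoeff W v (q j) *s q j)) (q k) = 0"
proof -
  have "(\<Sum>j\<in>S. wcoeff W v (q j) * winner W (q j) (q k))
    = (\<Sum>j\<in>S. if j = k then wcoeff W v (q k) * winner W (q k) (q k) else 0)"
    using orth by (intro sum.cong) auto
  also have "\<dots> = winner W v (q k)"
    using assms(1-3) by (simp add: wcoeff_def)
  finally show ?thesis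
    by (simp add: winner_diff_left winner_sum_left winner_scale_left)
qed

end

section \<open>Orthogonality in the GCR iteration\<close>

lemma gcr_defined_Suc:
  "gcr_defined A H W b x0 (Suc i) \<longleftrightarrow>
    gcr_defined A H W b x0 i \<and> gcr_delta A H W b x0 i \<noteq> 0"
  by (auto simp: gcr_defined_def less_Suc_eq)

lemma gcr_defined_mono:
  "gcr_defined A H W b x0 i \<Longrightarrow> j \<le> i \<Longrightarrow> gcr_defined A H W b x0 j"
  by (auto simp: gcr_defined_def)

context
  fixes A H W :: "'a::real_or_complex ^ 'n ^ 'n" and b x0 :: "'a ^ 'n"
  assumes W: "hermitian_posdef W"
begin

private abbreviation (input) r where "r \<equiv> gcr_r A H W b x0"
private abbreviation (input) q where "q i \<equiv> st_q (gcr A H W b x0 i)"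
private abbreviation (input) "defined \<equiv> gcr_defined A H W b x0"

lemma gcr_r_Suc: "r (Suc i) = r i - wcoeff W (r i) (q i) *s q i"
  by (simp add: gcr_r_def Let_def)

text \<open>
  Both clauses of the recursion have this form, the sum being empty for the first direction, so
  that no later induction on the directions has to treat index \<open>0\<close> separately.
\<close>

lemma gcr_q_gram_schmidt:
  "q i = (A ** H) *v r i - (\<Sum>j<i. wcoeff W ((A ** H) *v r i) (q j) *s q j)"
  by (cases i) (simp_all add: gcr_r_def Let_def matrix_vector_mul_assoc lessThan_Suc_atMost)

lemma gcr_q_orthogonal:
  assumes "defined i" "k < i"
  shows "winner W (q i) (q k) = 0"
  using assms
proof (induction i arbitrary: k rule: less_induct)
  case (less i)
  show ?case
  proof (subst gcr_q_gram_schmidt, rule gram_schmidt_orthogonal[OF W])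
    show "winner W (q k) (q k) \<noteq> 0"
      using less.prems by (auto simp: gcr_defined_def gcr_delta_def)
    show "winner W (q j) (q k) = 0" if "j \<in> {..<i}" "j \<noteq> k" for j
    proof (cases "k < j")
      case True
      then show ?thesis
        using less that gcr_defined_mono[OF less.prems(1), of j] by simp
    next
      case False
      then have "winner W (q k) (q j) = 0"
        using less that gcr_defined_mono[OF less.prems(1), of k] by simp
      then show ?thesis by (rule winner_orthogonal_sym[OF W])
    qed
  qed (use less.prems in auto)
qed

lemma gcr_r_orthogonal:
  assumes "defined i" "k < i"
  shows "winner W (r i) (q k) = 0"
  using assms
proof (induction i)
  case (Suc i)
  show ?case
  proof (cases "k = i")
    case True
    then show ?thesis
      using Suc.prems
      by (simp add: gcr_r_Suc winner_diff_left winner_scale_left wcoeff_def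
          gcr_defined_Suc gcr_delta_def)
  next
    case False
    then show ?thesis
      using Suc gcr_q_orthogonal[of i k]
      by (simp add: gcr_r_Suc winner_diff_left winner_scale_left gcr_defined_Suc)
  qed
qed simp

text \<open>
  The correction that Gram-Schmidt subtracts from \<open>B r\<^sub>i\<close> is invisible to \<open>r\<^sub>i\<close>, and removing it can
  only shorten the vector; both effects enter the decrease of the residual below.
\<close>

lemma gcr_winner_r_q:
  assumes "defined i"
  shows "winner W (q i) (r i) = winner W ((A ** H) *v r i) (r i)"
proof -
  have "winner W (q j) (r i) = 0" if "j < i" for j
    using gcr_r_orthogonal[OF assms that] by (rule winner_orthogonal_sym[OF W])
  then show ?thesis
    by (subst gcr_q_gram_schmidt) (simp add: winner_diff_left winner_sum_left winner_scale_left)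
qed

lemma gcr_wnorm_q_le:
  assumes "defined i"
  shows "(wnorm W (q i))\<^sup>2 \<le> (wnorm W ((A ** H) *v r i))\<^sup>2"
proof -
  define s where "s = (\<Sum>j<i. wcoeff W ((A ** H) *v r i) (q j) *s q j)"
  have "winner W (q i) s = 0"
    unfolding s_def using assms by (intro winner_orthogonal_sum[OF W] gcr_q_orthogonal) auto
  then have "(wnorm W (q i + s))\<^sup>2 = (wnorm W (q i))\<^sup>2 + (wnorm W s)\<^sup>2"
    by (rule wnorm_pythagoras[OF W])
  moreover have "q i + s = (A ** H) *v r i"
    unfolding s_def by (subst gcr_q_gram_schmidt) simp
  ultimately show ?thesis by simp
qed

section \<open>Decrease of the residual\<close>

lemma gcr_r_nonzero:
  assumes "defined (Suc i)"
  shows "r i \<noteq> 0"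
proof
  assume "r i = 0"
  then have "wnorm W (q i) = 0"
    using assms gcr_wnorm_q_le[of i] winner_self[OF W, of 0] by (simp add: gcr_defined_Suc)
  then show False
    using assms winner_self[OF W, of "q i"] by (simp add: gcr_defined_Suc gcr_delta_def)
qed

lemma gcr_r_step:
  assumes "defined (Suc i)"
  shows "(wnorm W (r (Suc i)))\<^sup>2 \<le> (wnorm W (r i))\<^sup>2 *
    (1 - (norm (winner W ((A ** H) *v r i) (r i)))\<^sup>2 /
      ((wnorm W ((A ** H) *v r i))\<^sup>2 * (wnorm W (r i))\<^sup>2))"
proof -
  let ?g = "(norm (winner W ((A ** H) *v r i) (r i)))\<^sup>2"
  have d: "defined i" "winner W (q i) (q i) \<noteq> 0"
    using assms by (auto simp: gcr_defined_Suc gcr_delta_def)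
  have qpos: "0 < (wnorm W (q i))\<^sup>2"
    using d(2) winner_self[OF W, of "q i"] by auto
  have "norm (winner W (r i) (q i)) = norm (winner W ((A ** H) *v r i) (r i))"
    using gcr_winner_r_q[OF d(1)] winner_commute_conjg[OF W, of "r i" "q i"] by simp
  then have "(wnorm W (r (Suc i)))\<^sup>2 = (wnorm W (r i))\<^sup>2 - ?g / (wnorm W (q i))\<^sup>2"
    using wnorm_remove_component[OF W d(2), of "r i"] by (simp add: gcr_r_Suc)
  also have "\<dots> \<le> (wnorm W (r i))\<^sup>2 - ?g / (wnorm W ((A ** H) *v r i))\<^sup>2"
    using qpos gcr_wnorm_q_le[OF d(1)]
    by (intro diff_left_mono divide_left_mono) (auto intro!: mult_pos_pos)
  also have "\<dots> = (wnorm W (r i))\<^sup>2 * (1 - ?g / ((wnorm W ((A ** H) *v r i))\<^sup>2 * (wnorm W (r i))\<^sup>2))"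
    using wnorm_pos[OF W gcr_r_nonzero[OF assms]] by (simp add: field_simps)
  finally show ?thesis .
qed

end

theorem theorem3:
  fixes A H W :: "'a::real_or_complex ^ 'n ^ 'n" and b x0 :: "'a ^ 'n" and i :: nat
  assumes "invertible A" and "invertible H" and "hermitian_posdef W"
    and "b - A *v x0 \<noteq> 0"
    and "gcr_defined A H W b x0 i"
  shows "wnorm W (gcr_r A H W b x0 i) / wnorm W (gcr_r A H W b x0 0)
    \<le> sqrt (1 - (INF y\<in>{y :: 'a ^ 'n. y \<noteq> 0}.
          (norm (winner W ((A ** H) *v y) y))\<^sup>2 /
          ((wnorm W ((A ** H) *v y))\<^sup>2 * (wnorm W y)\<^sup>2))) ^ i"
proof -
  note W = \<open>hermitian_posdef W\<close>
  define Q where "Q y = (norm (winner W ((A ** H) *v y) y))\<^sup>2 /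
    ((wnorm W ((A ** H) *v y))\<^sup>2 * (wnorm W y)\<^sup>2)" for y
  define s where "s = sqrt (1 - (INF y\<in>{y. y \<noteq> 0}. Q y))"
  let ?r = "gcr_r A H W b x0"
  have step: "wnorm W (?r (Suc j)) \<le> wnorm W (?r j) * s"
    if "gcr_defined A H W b x0 (Suc j)" for j
  proof -
    have "bdd_below (Q ` {y. y \<noteq> 0})"
      by (rule bdd_belowI[of _ 0]) (auto simp: Q_def)
    then have "(INF y\<in>{y. y \<noteq> 0}. Q y) \<le> Q (?r j)"
      using gcr_r_nonzero[OF W that] by (intro cINF_lower) auto
    then have "(wnorm W (?r j))\<^sup>2 * (1 - Q (?r j))
      \<le> (wnorm W (?r j))\<^sup>2 * (1 - (INF y\<in>{y. y \<noteq> 0}. Q y))"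
      by (intro mult_left_mono) auto
    then have "(wnorm W (?r (Suc j)))\<^sup>2 \<le> (wnorm W (?r j))\<^sup>2 * (1 - (INF y\<in>{y. y \<noteq> 0}. Q y))"
      using gcr_r_step[OF W that] unfolding Q_def by linarith
    then have "sqrt ((wnorm W (?r (Suc j)))\<^sup>2)
      \<le> sqrt ((wnorm W (?r j))\<^sup>2 * (1 - (INF y\<in>{y. y \<noteq> 0}. Q y)))"
      by (rule real_sqrt_le_mono)
    then show ?thesis
      by (simp add: real_sqrt_mult s_def wnorm_nonneg[OF W])
  qed
  have "wnorm W (?r i) \<le> wnorm W (?r 0) * s ^ i"
    using \<open>gcr_defined A H W b x0 i\<close>
  proof (induction i)
    case (Suc i)
    (* A square root of a negative real counts as negative, so the sign of s needs an argument:
       s is at least the ratio of two consecutive residual norms, hence nonnegative. *)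
    have "0 \<le> wnorm W (?r i) * s"
      using step[OF Suc.prems] wnorm_nonneg[OF W, of "?r (Suc i)"] by linarith
    then have "0 \<le> s"
      using wnorm_pos[OF W gcr_r_nonzero[OF W Suc.prems]] by (simp add: zero_le_mult_iff)
    then have "wnorm W (?r i) * s \<le> wnorm W (?r 0) * s ^ i * s"
      using Suc by (intro mult_right_mono) (auto simp: gcr_defined_Suc)
    then show ?case
      using step[OF Suc.prems] by (simp add: mult_ac)
  qed simp
  moreover have "0 < wnorm W (?r 0)"
    using \<open>b - A *v x0 \<noteq> 0\<close> by (intro wnorm_pos[OF W]) (simp add: gcr_r_def Let_def)
  ultimately have "wnorm W (?r i) / wnorm W (?r 0) \<le> s ^ i"
    by (simp add: divide_le_eq mult.commute)
  then show ?thesis unfolding s_def Q_def .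
qed

end
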